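(* Let $P$ be a (strictly) convex polyhedron in Euclidean $3$-space all of whose faces are regular polygons. Then every vertex of $P$ is rigid.
   Context: A polyhedron means a strictly-convex Euclidean realization of a polyhedral graph, i.e. of a 3-connected planar graph with no loops and no multiple edges. Different faces may be regular polygons with different numbers of sides. The non-triangular degree of a vertex $v$ is the number of non-triangular faces adjacent to (i.e. incident with) $v$. A vertex is (combinatorially) rigid if its non-triangular degree is at most $3$. *)

theory Defs
  imports "HOL-Analysis.Analysis"
begin

text \<open>
  A strictly convex realization in Euclidean space of a polyhedral graph is the boundary
  complex of a full-dimensional convex polytope: since the faces are the facets of the polytope,
  distinct faces span distinct planes and no vertex lies in the interior of an edge or of a face.
  (The library constant \<^const>\<open>polyhedron\<close> is a different notion: it also covers unbounded and
  lower-dimensional intersections of half-spaces.)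
\<close>

definition convex_polyhedron :: "(real^3) set \<Rightarrow> bool" where
  "convex_polyhedron P \<longleftrightarrow> polytope P \<and> aff_dim P = 3"

text \<open>The unoriented angle at \<open>v\<close> between the rays towards \<open>a\<close> and \<open>b\<close> (for \<open>a, b \<noteq> v\<close>).\<close>

definition angle_at :: "'a::euclidean_space \<Rightarrow> 'a \<Rightarrow> 'a \<Rightarrow> real" where
  "angle_at v a b = arccos (((a - v) \<bullet> (b - v)) / (norm (a - v) * norm (b - v)))"

text \<open>
  A regular polygon is an equilateral and equiangular convex polygon.  Edges have affine dimension
  1, so the endpoints of a segment that is an edge are automatically distinct; the conditions
  \<open>a \<noteq> b\<close> and \<open>a' \<noteq> b'\<close> say that the two edges meeting at a vertex are different.
\<close>

definition equilateral :: "'a::euclidean_space set \<Rightarrow> bool" where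
  "equilateral F \<longleftrightarrow>
     (\<forall>a b a' b'. closed_segment a b edge_of F \<and> closed_segment a' b' edge_of F
        \<longrightarrow> dist a b = dist a' b')"

definition equiangular :: "'a::euclidean_space set \<Rightarrow> bool" where
  "equiangular F \<longleftrightarrow>
     (\<forall>v a b v' a' b'.
        closed_segment v a edge_of F \<and> closed_segment v b edge_of F \<and> a \<noteq> b \<and>
        closed_segment v' a' edge_of F \<and> closed_segment v' b' edge_of F \<and> a' \<noteq> b'
        \<longrightarrow> angle_at v a b = angle_at v' a' b')"

definition regular_polygon :: "'a::euclidean_space set \<Rightarrow> bool" where
  "regular_polygon F \<longleftrightarrow> polytope F \<and> aff_dim F = 2 \<and> equilateral F \<and> equiangular F"

text \<open>
  The faces of a 3-dimensional polyhedron are its facets, and a triangle is a 2-simplex.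
  A polytope has only finitely many facets, so the cardinality below is a genuine count.
\<close>

definition non_triangular_degree :: "(real^3) set \<Rightarrow> real^3 \<Rightarrow> nat" where
  "non_triangular_degree P v = card {F. F facet_of P \<and> v \<in> F \<and> \<not> 2 simplex F}"

definition rigid_vertex :: "(real^3) set \<Rightarrow> real^3 \<Rightarrow> bool" where
  "rigid_vertex P v \<longleftrightarrow> v extreme_point_of P \<and> non_triangular_degree P v \<le> 3"

end

theory Submission
  imports Defs
begin

text \<open>
  The classical reason is that the face angles at a vertex of a convex polyhedron sum to less than
  \<open>2 * pi\<close>, whereas a regular polygon that is not a triangle has all its angles at least \<open>pi / 2\<close>;
  so four of them do not fit around a vertex.  Both halves are carried out below with inner
  products instead of sums of angles: only the sign of a cosine matters.

  For the polygon (\<open>nontriangular_regular_polygon_nonacute\<close>): a polygon that is not a triangle has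
  at least four vertices; choose four, which Radon's theorem makes the corners of a convex quadrilateral.  Its angles
  cannot all be acute (\<open>crossing_diagonals_nonacute\<close>), so the polygon, whose angle at a corner
  contains the angle of the quadrilateral there, has a non-acute angle; being equiangular, it then
  has a non-acute angle at every vertex.

  For the vertex (\<open>no_four_nonacute_facets\<close>): take four facets at the vertex, put the vertex at the
  origin, and keep only the four halfspaces that they define.  Their intersection is a cone with
  four edges \<open>q12, q23, q34, q41\<close> in cyclic order, and with suitable lengths the convex
  quadrilateral spanned by them satisfies \<open>q12 + q34 = q23 + q41\<close> (its diagonals cross).  The facets
  of this cone contain those of the polyhedron, so all four angles between consecutive edges are
  non-acute.  Multiplying the two sides of the equation gives
  \<open>(q12 + q34) \<bullet> (q12 + q34) = (q12 + q34) \<bullet> (q23 + q41) \<le> 0\<close>, since the right-hand product consists of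
  the four inner products of consecutive edges.  So \<open>q12 + q34 = 0\<close>, which is impossible in a pointed
  cone.
\<close>

unbundle no set_product_syntax
unbundle cross3_syntax

section \<open>Four halfspaces with non-acute facets\<close>

lemma parallel_cross_if_orthogonal:
  fixes u v y :: "real^3"
  assumes "u \<bullet> y = 0" "v \<bullet> y = 0" "u \<times> v \<noteq> 0"
  obtains c where "y = c *\<^sub>R (u \<times> v)"
proof -
  define w where "w = u \<times> v"
  have "y \<times> w = 0"
    using assms(1,2) by (simp add: w_def Lagrange inner_commute)
  then have "collinear {0, w, y}"
    by (simp add: cross_eq_0 insert_commute)
  then show ?thesis
    using assms(3) that[of 0] that unfolding w_def collinear_lemma by fastforce
qed

text \<open>
  In the plane orthogonal to \<open>n\<close>, the cone dual to a non-acute sector spanned by \<open>a\<close> and \<open>b\<close> is a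
  non-obtuse sector, so the projections of \<open>p\<close> and \<open>q\<close> to that plane have a non-negative inner
  product.  In terms of edges: \<open>p \<times> n\<close> and \<open>n \<times> q\<close> direct the lines in which the
  planes orthogonal to \<open>p\<close> and \<open>q\<close> cut the plane orthogonal to \<open>n\<close>; the sector they bound
  contains \<open>a\<close> and \<open>b\<close>, so it is non-acute as well.  Since \<open>n\<close> is a multiple of \<open>a \<times> b\<close>, all this is
  one expansion of triple products in which every term has the right sign.
\<close>

lemma dual_of_nonacute_sector:
  fixes a b n p q :: "real^3"
  assumes "a \<bullet> b \<le> 0" "n \<bullet> a = 0" "n \<bullet> b = 0" "a \<times> b \<noteq> 0"
    and "p \<bullet> a \<le> 0" "p \<bullet> b \<le> 0" "q \<bullet> a \<le> 0" "q \<bullet> b \<le> 0"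
  shows "(p \<times> n) \<bullet> (n \<times> q) \<le> 0"
proof -
  obtain k where k: "n = k *\<^sub>R (a \<times> b)"
    using parallel_cross_if_orthogonal[of a n b] assms by (auto simp: inner_commute)
  have scale: "(p \<times> n) \<bullet> (n \<times> q) = k\<^sup>2 * ((p \<times> (a \<times> b)) \<bullet> ((a \<times> b) \<times> q))"
    by (simp add: k cross_mult_left cross_mult_right power2_eq_square)
  have "(p \<times> (a \<times> b)) \<bullet> ((a \<times> b) \<times> q) =
      (a \<bullet> b) * ((p \<bullet> b) * (q \<bullet> a) + (p \<bullet> a) * (q \<bullet> b))
      - ((a \<bullet> a) * ((p \<bullet> b) * (q \<bullet> b)) + (b \<bullet> b) * ((p \<bullet> a) * (q \<bullet> a)))"
    by (subst cross_skew[of "a \<times> b" q])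
      (simp add: Lagrange inner_diff_left inner_diff_right algebra_simps inner_commute)
  also have "\<dots> \<le> 0"
  proof -
    have "(a \<bullet> b) * ((p \<bullet> b) * (q \<bullet> a) + (p \<bullet> a) * (q \<bullet> b)) \<le> 0"
      using assms by (intro mult_nonpos_nonneg add_nonneg_nonneg mult_nonpos_nonpos) auto
    moreover have "0 \<le> (a \<bullet> a) * ((p \<bullet> b) * (q \<bullet> b)) + (b \<bullet> b) * ((p \<bullet> a) * (q \<bullet> a))"
      using assms by (intro mult_nonneg_nonneg add_nonneg_nonneg mult_nonpos_nonpos) auto
    ultimately show ?thesis by linarith
  qed
  finally show ?thesis
    by (simp add: scale mult_nonneg_nonpos)
qed

text \<open>
  The hypotheses say that each of the halfspaces \<open>n \<bullet> y \<le> 0\<close> contributes a proper facet to their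
  intersection, with \<open>x n\<close> in the interior of the facet of \<open>n\<close>.  If at most one coefficient of a linear
  relation were positive, say that of \<open>i\<close>, then in the inner product of the relation with \<open>x i\<close>
  the term of \<open>i\<close> vanishes and no other term is negative, so all other coefficients are \<open>0\<close>; but \<open>i\<close>
  is not the zero vector, being negative at the other points.
\<close>

lemma two_positive_coefficients:
  fixes N :: "'a::real_inner set"
  assumes "finite N" "2 \<le> card N"
    and on: "\<And>n. n \<in> N \<Longrightarrow> n \<bullet> x n = 0"
    and off: "\<And>n m. n \<in> N \<Longrightarrow> m \<in> N \<Longrightarrow> m \<noteq> n \<Longrightarrow> m \<bullet> x n < 0"
    and dep: "(\<Sum>n\<in>N. c n *\<^sub>R n) = 0"
    and k: "k \<in> N" "c k \<noteq> 0"
  shows "2 \<le> card {n \<in> N. 0 < c n}"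
proof (rule ccontr)
  assume "\<not> ?thesis"
  then have "card {n \<in> N. 0 < c n} \<le> Suc 0"
    by linarith
  then have "\<forall>n\<in>{n \<in> N. 0 < c n}. \<forall>m\<in>{n \<in> N. 0 < c n}. n = m"
    using \<open>finite N\<close> by (subst (asm) card_le_Suc0_iff_eq) auto
  then obtain i where i: "i \<in> N" "\<And>n. n \<in> N \<Longrightarrow> n \<noteq> i \<Longrightarrow> c n \<le> 0"
    using k(1) by (cases "\<exists>j\<in>N. 0 < c j") (force simp: not_less)+
  have nonneg: "0 \<le> c n * (n \<bullet> x i)" if "n \<in> N" for n
    using on[OF i(1)] off[OF i(1) that] i(2)[OF that]
    by (cases "n = i") (auto simp: mult_nonpos_nonpos less_imp_le)
  have "(\<Sum>n\<in>N. c n * (n \<bullet> x i)) = (\<Sum>n\<in>N. c n *\<^sub>R n) \<bullet> x i"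
    by (simp add: inner_sum_left)
  then have "(\<Sum>n\<in>N. c n * (n \<bullet> x i)) = 0"
    using dep by simp
  then have "c n * (n \<bullet> x i) = 0" if "n \<in> N" for n
    using nonneg that \<open>finite N\<close> by (simp add: sum_nonneg_eq_0_iff)
  then have zero: "c n = 0" if "n \<in> N" "n \<noteq> i" for n
    using off[OF i(1) that] that(1) by fastforce
  then have "(\<Sum>n\<in>N. c n *\<^sub>R n) = c i *\<^sub>R i"
    using \<open>finite N\<close> i(1) by (subst sum.remove[of _ i]) auto
  then have "i = 0"
    using dep zero k by (metis scaleR_eq_0_iff)
  obtain m where "m \<in> N" "m \<noteq> i"
    using assms(2) by (metis card_le_Suc0_iff_eq \<open>finite N\<close> not_less_eq_eq numeral_2_eq_2)
  then show False
    using off[of m i] i(1) \<open>i = 0\<close> by auto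
qed

text \<open>
  The sign pattern of a linear relation between the four normals tells which facets are opposite:
  by the preceding lemma there are two coefficients of either sign, and after rescaling the relation
  reads \<open>m1 + m3 = m2 + m4\<close>, the normals being in the cyclic order \<open>m1, m2, m3, m4\<close>.  Up to a
  common sign, the edges of the cone are the cross products of consecutive normals, and they inherit the relation
  \<open>q12 + q34 = q23 + q41\<close>.
\<close>

lemma no_four_nonacute_facets:
  fixes N :: "(real^3) set"
  assumes "card N = 4"
    and on: "\<And>n. n \<in> N \<Longrightarrow> n \<bullet> x n = 0"
    and off: "\<And>n m. n \<in> N \<Longrightarrow> m \<in> N \<Longrightarrow> m \<noteq> n \<Longrightarrow> m \<bullet> x n < 0"
    and sector: "\<And>n. n \<in> N \<Longrightarrow> \<exists>a b. a \<bullet> b \<le> 0 \<and> a \<times> b \<noteq> 0 \<and> n \<bullet> a = 0 \<and> n \<bullet> b = 0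
        \<and> (\<forall>m\<in>N. m \<bullet> a \<le> 0 \<and> m \<bullet> b \<le> 0)"
  shows False
proof -
  have fin: "finite N"
    using assms(1) by (simp add: card_ge_0_finite)
  have "dependent N"
    using assms(1) by (intro dependent_biggerset) simp
  then obtain c k where c: "(\<Sum>n\<in>N. c n *\<^sub>R n) = 0" "k \<in> N" "c k \<noteq> 0"
    using fin by (auto simp: dependent_finite)
  define S T where "S = {n \<in> N. 0 < c n}" and "T = {n \<in> N. 0 < - c n}"
  have "2 \<le> card S"
    unfolding S_def using two_positive_coefficients[OF fin _ on off c] assms(1) by simp
  moreover have "2 \<le> card T"
    unfolding T_def
    using two_positive_coefficients[OF fin _ on off, of "\<lambda>n. - c n" k] assms(1) c
    by (simp add: sum_negf)
  moreover have ST: "S \<inter> T = {}" "S \<union> T \<subseteq> N"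
    by (auto simp: S_def T_def)
  moreover have "card (S \<union> T) = card S + card T"
    using ST fin by (meson card_Un_disjoint finite_subset le_sup_iff)
  moreover have "card (S \<union> T) \<le> 4"
    using ST(2) fin assms(1) card_mono by metis
  ultimately have card: "card S = 2" "card T = 2" "card (S \<union> T) = card N"
    using assms(1) by auto
  then have N: "N = S \<union> T"
    using ST(2) fin card_subset_eq by blast
  obtain n1 n3 n2 n4 where S: "S = {n1, n3}" "n1 \<noteq> n3" and T: "T = {n2, n4}" "n2 \<noteq> n4"
    using card(1,2) by (auto simp: card_2_iff)
  define m1 m2 m3 m4 where
    m: "m1 = c n1 *\<^sub>R n1" "m2 = (- c n2) *\<^sub>R n2" "m3 = c n3 *\<^sub>R n3" "m4 = (- c n4) *\<^sub>R n4"
  have pos: "0 < c n1" "0 < c n3" "0 < - c n2" "0 < - c n4"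
    using S T by (auto simp: S_def T_def)
  have diff: "n1 \<noteq> n2" "n1 \<noteq> n4" "n3 \<noteq> n2" "n3 \<noteq> n4"
    using ST(1) S T by auto
  have mem: "n1 \<in> N" "n2 \<in> N" "n3 \<in> N" "n4 \<in> N"
    using N S T by auto
  have "(\<Sum>n\<in>N. c n *\<^sub>R n) = m1 + m3 - (m2 + m4)"
    using S T diff by (simp add: N m)
  then have m4: "m4 = m1 + m3 - m2"
    using c(1) by (simp add: algebra_simps)
  \<comment> \<open>Scaling the middle normal is harmless whatever the sign of the factor, as it enters twice.\<close>
  have consecutive: "((\<alpha> *\<^sub>R p) \<times> (\<beta> *\<^sub>R n)) \<bullet> ((\<beta> *\<^sub>R n) \<times> (\<gamma> *\<^sub>R q)) \<le> 0"
    if "p \<in> N" "n \<in> N" "q \<in> N" "0 < \<alpha>" "0 < \<gamma>" for \<alpha> \<beta> \<gamma> p n q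
  proof -
    obtain a b where ab: "a \<bullet> b \<le> 0" "a \<times> b \<noteq> 0" "n \<bullet> a = 0" "n \<bullet> b = 0"
        "\<forall>m\<in>N. m \<bullet> a \<le> 0 \<and> m \<bullet> b \<le> 0"
      using sector[OF \<open>n \<in> N\<close>] by blast
    show ?thesis
      by (rule dual_of_nonacute_sector[of a b])
        (use ab that in \<open>auto simp: mult_nonneg_nonpos\<close>)
  qed
  define q12 q23 q34 q41 where
    q: "q12 = m1 \<times> m2" "q23 = m2 \<times> m3" "q34 = m3 \<times> m4" "q41 = m4 \<times> m1"
  have "q12 \<bullet> q23 \<le> 0" "q23 \<bullet> q34 \<le> 0" "q34 \<bullet> q41 \<le> 0" "q41 \<bullet> q12 \<le> 0"
    unfolding q m by (rule consecutive; use mem pos in simp)+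
  moreover have "q12 + q34 = q23 + q41"
    unfolding q m4
    by (simp add: cross_add_left cross_add_right Cross3.left_diff_distrib Cross3.right_diff_distrib
        cross_skew[of m3 m2] cross_skew[of m2 m1])
  moreover have "(q12 + q34) \<bullet> (q23 + q41)
      = q12 \<bullet> q23 + q23 \<bullet> q34 + q34 \<bullet> q41 + q41 \<bullet> q12"
    by (simp add: inner_add_left inner_add_right inner_commute)
  ultimately have "(q12 + q34) \<bullet> (q12 + q34) \<le> 0"
    by simp
  then have "(q12 + q34) \<bullet> (q12 + q34) = 0"
    by (metis inner_ge_zero order_antisym)
  then have "q12 + q34 = 0"
    by (simp only: inner_eq_zero_iff)
  moreover have "q12 + q34 = (m3 - m2) \<times> (m1 - m2)"
    unfolding q m4
    by (simp add: cross_add_left cross_add_right Cross3.left_diff_distrib Cross3.right_diff_distrib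
        cross_skew[of m2 m1])
  \<comment> \<open>A vanishing sum means that the tips of the rescaled normals lie on a line, so three of them are
    linearly dependent; the points \<open>x n1\<close>, \<open>x n2\<close>, \<open>x n3\<close> exclude this.\<close>
  ultimately have "collinear {0, m3 - m2, m1 - m2}"
    by (simp add: cross_eq_0)
  then consider "m3 = m2" | "m1 = m2" | r where "m1 - m2 = r *\<^sub>R (m3 - m2)"
    by (auto simp: collinear_lemma)
  then show False
  proof cases
    case 1
    then have "c n3 * (n3 \<bullet> x n2) = - c n2 * (n2 \<bullet> x n2)"
      by (metis m(2,3) inner_scaleR_left)
    then show False
      using on[OF mem(2)] off[OF mem(2,3)] diff pos by auto
  next
    case 2
    then have "c n1 * (n1 \<bullet> x n2) = - c n2 * (n2 \<bullet> x n2)"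
      by (metis m(1,2) inner_scaleR_left)
    then show False
      using on[OF mem(2)] off[OF mem(2,1)] diff pos by auto
  next
    case 3
    then have "m1 = m2 + r *\<^sub>R (m3 - m2)"
      by (metis add.commute diff_add_cancel)
    then have "m1 \<bullet> y = (m2 + r *\<^sub>R (m3 - m2)) \<bullet> y" for y
      by simp
    then have *: "m1 \<bullet> y = (1 - r) * (m2 \<bullet> y) + r * (m3 \<bullet> y)" for y
      by (simp add: inner_add_left inner_diff_left left_diff_distrib right_diff_distrib)
    \<comment> \<open>Evaluation at \<open>x n2\<close> and \<open>x n3\<close> shows that \<open>m1\<close> is a positive combination of \<open>m2\<close> and \<open>m3\<close>, which
      is negative at \<open>x n1\<close>.\<close>
    have m0: "m1 \<bullet> x n1 = 0" "m2 \<bullet> x n2 = 0" "m3 \<bullet> x n3 = 0"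
      using on mem by (auto simp: m)
    have mneg: "m2 \<bullet> x n1 < 0" "m3 \<bullet> x n1 < 0" "m1 \<bullet> x n2 < 0" "m3 \<bullet> x n2 < 0"
        "m1 \<bullet> x n3 < 0" "m2 \<bullet> x n3 < 0"
      unfolding m inner_scaleR_left
      by (rule mult_pos_neg; use off mem diff S(2) pos in simp; fail)+
    have "0 < r"
      using *[of "x n2"] m0 mneg by (simp add: zero_less_mult_iff mult_less_0_iff)
    moreover have "0 < 1 - r"
      using *[of "x n3"] m0 mneg by (simp add: mult_less_0_iff)
    ultimately have "(1 - r) * (m2 \<bullet> x n1) + r * (m3 \<bullet> x n1) < 0"
      using mneg by (intro add_neg_neg mult_pos_neg)
    then show False
      using *[of "x n1"] m0 by simp
  qed
qed

section \<open>Non-acute angles of polygons\<close>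

text \<open>
  Put the crossing point \<open>z\<close> at the origin, so that \<open>p3 = - s p1\<close> and \<open>p4 = - t p2\<close>.  If the angles at the
  opposite corners \<open>p1\<close> and \<open>p3\<close> are acute, then the weighted sum of the two inner products, with weights
  \<open>s\<close> and \<open>1\<close> chosen to cancel the mixed term, yields \<open>t (p2 \<bullet> p2) < s (p1 \<bullet> p1)\<close>.
  The other two corners yield the opposite inequality.
\<close>

lemma crossing_diagonals_nonacute:
  fixes p1 p2 p3 p4 z :: "'a::real_inner"
  assumes "z \<in> open_segment p1 p3" "z \<in> open_segment p2 p4"
  shows "(p2 - p1) \<bullet> (p4 - p1) \<le> 0 \<or> (p3 - p2) \<bullet> (p1 - p2) \<le> 0 \<or>
         (p4 - p3) \<bullet> (p2 - p3) \<le> 0 \<or> (p1 - p4) \<bullet> (p3 - p4) \<le> 0"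
proof (rule ccontr)
  have opposite: "\<exists>s>0. q = z - s *\<^sub>R (p - z)" if "z \<in> open_segment p q" for p q
  proof -
    obtain u where u: "0 < u" "u < 1" "z = (1 - u) *\<^sub>R p + u *\<^sub>R q"
      using \<open>z \<in> open_segment p q\<close> by (auto simp: in_segment)
    define s where "s = (1 - u) / u"
    have "0 < s"
      using u(1,2) by (simp add: s_def)
    have "u *\<^sub>R (q - z) = - (1 - u) *\<^sub>R (p - z)"
      by (simp add: u(3) algebra_simps)
    also have "1 - u = u * s"
      using u(1) by (simp add: s_def)
    also have "- (u * s) *\<^sub>R (p - z) = u *\<^sub>R (- s *\<^sub>R (p - z))"
      by simp
    finally have "q - z = - s *\<^sub>R (p - z)"
      using u(1) by (metis less_irrefl real_vector.scale_left_imp_eq)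
    then have "q = z - s *\<^sub>R (p - z)"
      by (simp add: algebra_simps)
    then show ?thesis
      using \<open>0 < s\<close> by blast
  qed
  obtain s where s: "0 < s" "p3 = z - s *\<^sub>R (p1 - z)"
    using opposite assms(1) by blast
  obtain t where t: "0 < t" "p4 = z - t *\<^sub>R (p2 - z)"
    using opposite assms(2) by blast
  define p q where "p = p1 - z" and "q = p2 - z"
  have eq: "p1 = z + p" "p2 = z + q" "p3 = z - s *\<^sub>R p" "p4 = z - t *\<^sub>R q"
    by (simp_all add: p_def q_def s(2) t(2))
  define A B C where "A = p \<bullet> p" and "B = q \<bullet> q" and "C = p \<bullet> q"
  assume "\<not> ?thesis"
  then have
    1: "0 < A - t * B + (t - 1) * C" and
    2: "0 < B - s * A + (s - 1) * C" and
    3: "0 < s\<^sup>2 * A - t * B - s * (t - 1) * C" and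
    4: "0 < t\<^sup>2 * B - s * A - t * (s - 1) * C"
    by (auto simp: eq A_def B_def C_def algebra_simps inner_commute power2_eq_square)
  have "0 < s * (A - t * B + (t - 1) * C) + (s\<^sup>2 * A - t * B - s * (t - 1) * C)"
    by (rule add_pos_pos[OF mult_pos_pos[OF s(1) 1] 3])
  also have "\<dots> = (1 + s) * (s * A - t * B)"
    by (simp add: algebra_simps power2_eq_square)
  finally have "0 < s * A - t * B"
    using s(1) by (simp add: zero_less_mult_iff)
  have "0 < t * (B - s * A + (s - 1) * C) + (t\<^sup>2 * B - s * A - t * (s - 1) * C)"
    by (rule add_pos_pos[OF mult_pos_pos[OF t(1) 2] 4])
  also have "\<dots> = (1 + t) * (t * B - s * A)"
    by (simp add: algebra_simps power2_eq_square)
  finally have "0 < t * B - s * A"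
    using t(1) by (simp add: zero_less_mult_iff)
  with \<open>0 < s * A - t * B\<close> show False
    by simp
qed

text \<open>
  Four points in a plane have a Radon partition.  No extreme point lies in the hull of the others,
  so both parts are pairs, and the two segments are the crossing diagonals of a quadrilateral.
\<close>

lemma nonacute_angle_among_four_extreme_points:
  fixes F :: "'a::euclidean_space set"
  assumes "convex F" "aff_dim F = 2" "card E = 4" "\<And>x. x \<in> E \<Longrightarrow> x extreme_point_of F"
  obtains p q r where "p \<in> E" "q \<in> E" "r \<in> E" "q \<noteq> p" "r \<noteq> p" "(q - p) \<bullet> (r - p) \<le> 0"
proof -
  have fin: "finite E"
    using assms(3) by (simp add: card_ge_0_finite)
  have EF: "E \<subseteq> F"
    using assms(4) by (auto simp: extreme_point_of_def)
  then have "aff_dim E \<le> 2"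
    using aff_dim_subset assms(2) by metis
  then have "affine_dependent E"
    using affine_independent_iff_card[of E] assms(3) by fastforce
  then obtain M K where MK: "M \<inter> K = {}" "M \<union> K = E" "convex hull M \<inter> convex hull K \<noteq> {}"
    using Radon_partition[OF fin] by blast
  have finMK: "finite M" "finite K"
    using MK(2) fin by auto
  have not_hull: "x \<notin> convex hull X" if "x \<in> E" "X \<subseteq> E" "x \<notin> X" for x X
  proof -
    have "convex (F - {x})"
      using assms(1,4) that(1) extreme_point_of_stillconvex by blast
    then have "convex hull X \<subseteq> F - {x}"
      using that EF by (intro hull_minimal) auto
    then show ?thesis by blast
  qed
  have two: "2 \<le> card X"
    if XY: "X \<inter> Y = {}" "X \<subseteq> E" "Y \<subseteq> E" "convex hull X \<inter> convex hull Y \<noteq> {}" "finite X" for X Y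
  proof (rule ccontr)
    assume "\<not> 2 \<le> card X"
    moreover have "card X \<noteq> 0"
      using XY by auto
    ultimately have "card X = 1"
      by linarith
    then obtain x where "X = {x}"
      by (rule card_1_singletonE)
    then show False
      using XY not_hull[of x Y] by auto
  qed
  have "2 \<le> card M"
    using two[of M K] MK finMK by auto
  moreover have "2 \<le> card K"
    using two[of K M] MK finMK by auto
  moreover have "card M + card K = 4"
    using MK finMK assms(3) by (metis card_Un_disjoint)
  ultimately have "card M = 2" "card K = 2"
    by auto
  then obtain p1 p3 p2 p4 where M: "M = {p1, p3}" "p1 \<noteq> p3" and K: "K = {p2, p4}" "p2 \<noteq> p4"
    by (auto simp: card_2_iff)
  obtain z where z: "z \<in> closed_segment p1 p3" "z \<in> closed_segment p2 p4"
    using MK(3) by (auto simp: M K segment_convex_hull)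
  have "z \<notin> M"
    using not_hull[of z K] MK z(2) by (auto simp: K segment_convex_hull)
  moreover have "z \<notin> K"
    using not_hull[of z M] MK z(1) by (auto simp: M segment_convex_hull)
  ultimately have "z \<in> open_segment p1 p3" "z \<in> open_segment p2 p4"
    using z by (auto simp: open_segment_def M K)
  then have "(p2 - p1) \<bullet> (p4 - p1) \<le> 0 \<or> (p3 - p2) \<bullet> (p1 - p2) \<le> 0 \<or>
         (p4 - p3) \<bullet> (p2 - p3) \<le> 0 \<or> (p1 - p4) \<bullet> (p3 - p4) \<le> 0"
    by (rule crossing_diagonals_nonacute)
  moreover have "p1 \<in> E" "p2 \<in> E" "p3 \<in> E" "p4 \<in> E"
    using MK(2) M K by auto
  moreover have "p1 \<noteq> p2" "p1 \<noteq> p4" "p3 \<noteq> p2" "p3 \<noteq> p4"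
    using MK(1) M K by auto
  ultimately show ?thesis
    using that M(2) K(2) by metis
qed

lemma four_extreme_points_if_not_triangle:
  fixes F :: "'a::euclidean_space set"
  assumes "polytope F" "aff_dim F = 2" "\<not> 2 simplex F"
  obtains E where "card E = 4" "\<forall>x\<in>E. x extreme_point_of F"
proof -
  define V where "V = {x. x extreme_point_of F}"
  have F: "F = convex hull V"
    unfolding V_def using assms(1) by (intro Krein_Milman_Minkowski) 
      (auto simp: polytope_imp_compact polytope_imp_convex)
  have fin: "finite V"
    unfolding V_def using assms(1) by (simp add: finite_polyhedron_extreme_points polytope_imp_polyhedron)
  have dim: "aff_dim V = 2"
    using assms(2) F by (metis aff_dim_convex_hull)
  have "4 \<le> card V"
  proof (rule ccontr)
    assume "\<not> ?thesis"
    moreover have "aff_dim V \<le> int (card V) - 1"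
      using fin by (rule aff_dim_le_card)
    ultimately have "card V = 3"
      using dim by linarith
    then have "\<not> affine_dependent V"
      using affine_independent_iff_card[of V] fin dim by simp
    then show False
      using assms(3) \<open>card V = 3\<close> F by (auto simp: simplex_def)
  qed
  then show ?thesis
    using obtain_subset_with_card_n[of 4 V] that by (metis V_def mem_Collect_eq subsetD)
qed

section \<open>The two edges at a vertex of a polygon\<close>

text \<open>
  A collinear exposed face through an extreme point is a segment, and the extreme point can only
  be one of its ends.
\<close>

lemma edge_from_supporting_functional:
  fixes F :: "'a::euclidean_space set"
  assumes "polytope F" "p extreme_point_of F"
    and supp: "\<And>x. x \<in> F \<Longrightarrow> 0 \<le> g \<bullet> (x - p)"
    and y: "y \<in> F" "y \<noteq> p" "g \<bullet> (y - p) = 0"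
    and col: "collinear {x \<in> F. g \<bullet> (x - p) = 0}"
  obtains a where "closed_segment p a edge_of F" "a \<in> F" "a \<noteq> p" "g \<bullet> (a - p) = 0"
proof -
  define G where "G = F \<inter> {x. g \<bullet> x = g \<bullet> p}"
  have G: "G = {x \<in> F. g \<bullet> (x - p) = 0}"
    by (auto simp: G_def inner_diff_right)
  have face: "G face_of F"
    unfolding G_def using assms(1) supp
    by (intro face_of_Int_supporting_hyperplane_ge)
      (auto simp: polytope_imp_convex inner_diff_right)
  have pG: "p \<in> G"
    using assms(2) by (auto simp: G extreme_point_of_def)
  have "compact G" "convex G"
    using face_of_imp_compact[OF polytope_imp_convex polytope_imp_compact, OF assms(1,1) face]
      face_of_imp_convex[OF face] by auto
  then obtain d e where de: "G = closed_segment d e"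
    using compact_convex_collinear_segment[of G] col pG by (metis G empty_iff)
  have "p extreme_point_of G"
    using face assms(2) pG by (simp add: extreme_point_of_face)
  then have "p = d \<or> p = e"
    by (simp add: de extreme_point_of_segment)
  then obtain a where a: "G = closed_segment p a"
    using de closed_segment_commute by metis
  have "y \<in> G"
    using y by (simp add: G)
  then have "a \<noteq> p"
    using a y(2) by auto
  moreover have "aff_dim G = 1"
    using \<open>a \<noteq> p\<close> by (simp add: a segment_convex_hull aff_dim_convex_hull)
  moreover have "a \<in> G"
    by (simp add: a)
  ultimately show ?thesis
    using that[of a] face a by (auto simp: edge_of_def G)
qed

text \<open>
  Here \<open>(l, w)\<close> are coordinates on the plane of \<open>F\<close> with \<open>p\<close> as origin, and all of \<open>F\<close> except \<open>p\<close> lies where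
  \<open>l\<close> is positive.  Among the finitely many generating points other than \<open>p\<close>, one has the least slope
  \<open>w / l\<close>; the line through \<open>p\<close> of that slope supports \<open>F\<close> and carries an edge.  The non-vanishing
  determinant \<open>l \<bullet> (n \<times> w)\<close> says that \<open>l\<close> and \<open>w\<close> are independent on the plane.
\<close>

lemma extreme_slope_edge:
  fixes F :: "(real^3) set"
  assumes "polytope F" "p extreme_point_of F" "F \<noteq> {p}"
    and plane: "\<And>x. x \<in> F \<Longrightarrow> n \<bullet> (x - p) = 0"
    and pos: "\<And>x. x \<in> F \<Longrightarrow> x \<noteq> p \<Longrightarrow> 0 < l \<bullet> (x - p)"
    and indep: "l \<bullet> (n \<times> w) \<noteq> 0"
  obtains a s where "closed_segment p a edge_of F" "a \<in> F" "a \<noteq> p"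
    "w \<bullet> (a - p) = s * (l \<bullet> (a - p))"
    "\<And>x. x \<in> F \<Longrightarrow> s * (l \<bullet> (x - p)) \<le> w \<bullet> (x - p)"
proof -
  obtain V where V: "finite V" "F = convex hull V"
    using assms(1) by (auto simp: polytope_def)
  have VF: "V \<subseteq> F"
    by (simp add: V(2) hull_subset)
  have "V - {p} \<noteq> {}"
  proof
    assume "V - {p} = {}"
    then have "F \<subseteq> {p}"
      unfolding V(2) by (intro hull_minimal) auto
    then show False
      using assms(2,3) by (auto simp: extreme_point_of_def)
  qed
  define slope where "slope x = (w \<bullet> (x - p)) / (l \<bullet> (x - p))" for x
  obtain y where y: "y \<in> V" "y \<noteq> p" and min: "\<And>x. x \<in> V \<Longrightarrow> x \<noteq> p \<Longrightarrow> slope y \<le> slope x"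
    using ex_min_if_finite[of "slope ` (V - {p})"] V(1) \<open>V - {p} \<noteq> {}\<close>
    by (force simp: not_less)
  define s g where "s = slope y" and "g = w - s *\<^sub>R l"
  have g: "g \<bullet> v = w \<bullet> v - s * (l \<bullet> v)" for v
    by (simp add: g_def inner_diff_left)
  have "0 \<le> g \<bullet> (x - p)" if "x \<in> V" for x
  proof (cases "x = p")
    case False
    then have "s \<le> slope x" "0 < l \<bullet> (x - p)"
      using min pos that VF by (auto simp: s_def)
    then show ?thesis
      by (simp add: g slope_def field_simps)
  qed simp
  then have "V \<subseteq> {x. g \<bullet> x \<ge> g \<bullet> p}"
    by (auto simp: inner_diff_right)
  then have "F \<subseteq> {x. g \<bullet> x \<ge> g \<bullet> p}"
    unfolding V(2) by (intro hull_minimal convex_halfspace_ge)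
  then have supp: "0 \<le> g \<bullet> (x - p)" if "x \<in> F" for x
    using that by (auto simp: inner_diff_right)
  have gy: "g \<bullet> (y - p) = 0"
    using pos[of y] y VF by (auto simp: g s_def slope_def)
  have "l \<bullet> (n \<times> g) = l \<bullet> (n \<times> w)"
    by (simp add: g_def Cross3.right_diff_distrib cross_mult_right inner_diff_right dot_cross_self)
  then have "n \<times> g \<noteq> 0"
    using indep by auto
  have "collinear {x \<in> F. g \<bullet> (x - p) = 0}"
    unfolding collinear_def
  proof (intro exI[of _ "n \<times> g"] ballI)
    fix x x' assume xx: "x \<in> {x \<in> F. g \<bullet> (x - p) = 0}" "x' \<in> {x \<in> F. g \<bullet> (x - p) = 0}"
    then have "n \<bullet> (x - x') = 0" "g \<bullet> (x - x') = 0"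
      using plane[of x] plane[of x'] by (auto simp: inner_diff_right)
    then show "\<exists>c. x - x' = c *\<^sub>R (n \<times> g)"
      using parallel_cross_if_orthogonal \<open>n \<times> g \<noteq> 0\<close> by metis
  qed
  then obtain a where "closed_segment p a edge_of F" "a \<in> F" "a \<noteq> p" "g \<bullet> (a - p) = 0"
    using edge_from_supporting_functional[OF assms(1,2) supp _ y(2) gy] y(1) VF by blast
  then show ?thesis
    using that[of a s] supp by (simp add: g)
qed

text \<open>
  The two edges at a vertex are those of least and greatest slope; the greatest slope is obtained
  from the least one by replacing \<open>w\<close> with \<open>- w\<close>.  Every point of \<open>F\<close> has a slope in between, and is
  therefore in the sector spanned by the edges.
\<close>

lemma polygon_vertex_edges:
  fixes F :: "(real^3) set"
  assumes "polytope F" "aff_dim F = 2" "p extreme_point_of F"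
  obtains a b where "closed_segment p a edge_of F" "closed_segment p b edge_of F" "a \<noteq> b"
    "a \<in> F" "b \<in> F" "(a - p) \<times> (b - p) \<noteq> 0"
    "\<And>x. x \<in> F \<Longrightarrow> \<exists>s\<ge>0. \<exists>t\<ge>0. x - p = s *\<^sub>R (a - p) + t *\<^sub>R (b - p)"
proof -
  have pF: "p \<in> F"
    using assms(3) by (simp add: extreme_point_of_def)
  obtain n d where n: "n \<noteq> 0" "affine hull F = {x. n \<bullet> x = d}"
    using assms(2) aff_dim_eq_hyperplane[of F] by auto
  have plane: "n \<bullet> (x - p) = 0" if "x \<in> F" for x
    using n(2) that pF hull_subset[of F affine] by (auto simp: inner_diff_right)
  have "F \<noteq> {p}"
    using assms(2) by auto
  have "{p} exposed_face_of F"
    using assms(1,3) by (simp add: exposed_face_of_polyhedron polytope_imp_polyhedron face_of_singleton)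
  then obtain h e where h: "F \<subseteq> {x. h \<bullet> x \<le> e}" "{p} = F \<inter> {x. h \<bullet> x = e}"
    by (auto simp: exposed_face_of_def)
  define l where "l = - h"
  have pos: "0 < l \<bullet> (x - p)" if "x \<in> F" "x \<noteq> p" for x
  proof -
    have "h \<bullet> x \<le> e" "h \<bullet> x \<noteq> e" "h \<bullet> p = e"
      using h that by auto
    then show ?thesis
      by (simp add: l_def inner_diff_right)
  qed
  define w where "w = n \<times> l"
  obtain x0 where x0: "x0 \<in> F" "x0 \<noteq> p"
    using pF \<open>F \<noteq> {p}\<close> by blast
  have "w \<noteq> 0"
  proof
    assume "w = 0"
    then obtain c where "l = c *\<^sub>R n"
      using n(1) unfolding w_def cross_eq_0 collinear_lemma by (metis scaleR_zero_left)
    then show False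
      using pos[OF x0] plane[OF x0(1)] by simp
  qed
  have det: "l \<bullet> (n \<times> w) = - (w \<bullet> w)"
    by (metis cross_skew cross_triple inner_commute inner_minus_left w_def)
  obtain a s where a: "closed_segment p a edge_of F" "a \<in> F" "a \<noteq> p"
      "w \<bullet> (a - p) = s * (l \<bullet> (a - p))"
      "\<And>x. x \<in> F \<Longrightarrow> s * (l \<bullet> (x - p)) \<le> w \<bullet> (x - p)"
    using extreme_slope_edge[OF assms(1,3) \<open>F \<noteq> {p}\<close> plane pos, of w] det \<open>w \<noteq> 0\<close> by auto
  obtain b t where b: "closed_segment p b edge_of F" "b \<in> F" "b \<noteq> p"
      "(- w) \<bullet> (b - p) = t * (l \<bullet> (b - p))"
      "\<And>x. x \<in> F \<Longrightarrow> t * (l \<bullet> (x - p)) \<le> (- w) \<bullet> (x - p)"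
    using extreme_slope_edge[OF assms(1,3) \<open>F \<noteq> {p}\<close> plane pos, of "- w"] det \<open>w \<noteq> 0\<close> by auto
  have la: "0 < l \<bullet> (a - p)" and lb: "0 < l \<bullet> (b - p)"
    using pos a b by auto
  have zero: "y = 0" if y: "n \<bullet> y = 0" "l \<bullet> y = 0" "w \<bullet> y = 0" for y
  proof -
    obtain c where "y = c *\<^sub>R w"
      using parallel_cross_if_orthogonal[OF y(1,2)] \<open>w \<noteq> 0\<close> w_def by metis
    then show ?thesis
      using y(3) \<open>w \<noteq> 0\<close> by simp
  qed
  \<comment> \<open>The least slope is \<open>s\<close> and the greatest is \<open>- t\<close>; if they agreed, \<open>F\<close> would lie on a line.\<close>
  have "s + t < 0"
  proof (rule ccontr)
    assume "\<not> s + t < 0"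
    have "collinear F"
      unfolding collinear_def
    proof (intro exI[of _ "a - p"] ballI)
      have *: "w \<bullet> (x - p) = s * (l \<bullet> (x - p))" if "x \<in> F" for x
      proof -
        have "0 \<le> l \<bullet> (x - p)"
          using pos[OF that] by (cases "x = p") auto
        then have "0 \<le> (s + t) * (l \<bullet> (x - p))"
          using \<open>\<not> s + t < 0\<close> by simp
        then show ?thesis
          using a(5)[OF that] b(5)[OF that] by (simp add: algebra_simps)
      qed
      fix x x' assume x: "x \<in> F" "x' \<in> F"
      define k where "k = (l \<bullet> (x - x')) / (l \<bullet> (a - p))"
      have l0: "l \<bullet> (x - x' - k *\<^sub>R (a - p)) = 0"
        using la by (simp add: k_def inner_diff_right[of l "x - x'"])
      have "w \<bullet> (x - x') = s * (l \<bullet> (x - x'))"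
        using *[OF x(1)] *[OF x(2)] by (simp add: inner_diff_right algebra_simps)
      then have "w \<bullet> (x - x' - k *\<^sub>R (a - p)) = s * (l \<bullet> (x - x' - k *\<^sub>R (a - p)))"
        using a(4) by (simp add: inner_diff_right[of _ "x - x'"] right_diff_distrib)
      moreover have "n \<bullet> (x - x' - k *\<^sub>R (a - p)) = 0"
        using plane[OF x(1)] plane[OF x(2)] plane[OF a(2)]
        by (simp add: inner_diff_right)
      ultimately have "x - x' - k *\<^sub>R (a - p) = 0"
        using l0 by (intro zero) auto
      then show "\<exists>c. x - x' = c *\<^sub>R (a - p)"
        by (metis eq_iff_diff_eq_0)
    qed
    then show False
      using assms(2) by (simp add: collinear_aff_dim)
  qed
  \<comment> \<open>These functionals vanish on one edge each, so they read off the coefficient of the other edge.\<close>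
  define ga gb where "ga y = w \<bullet> y - s * (l \<bullet> y)" and "gb y = - (w \<bullet> y) - t * (l \<bullet> y)" for y
  have ga_b: "0 < ga (b - p)"
  proof -
    have "ga (b - p) = - (s + t) * (l \<bullet> (b - p))"
      using b(4) by (simp add: ga_def algebra_simps)
    then show ?thesis
      using lb \<open>s + t < 0\<close> by (metis mult_pos_pos neg_0_less_iff_less)
  qed
  have gb_a: "0 < gb (a - p)"
  proof -
    have "gb (a - p) = - (s + t) * (l \<bullet> (a - p))"
      using a(4) by (simp add: gb_def algebra_simps)
    then show ?thesis
      using la \<open>s + t < 0\<close> by (metis mult_pos_pos neg_0_less_iff_less)
  qed
  have ga_a: "ga (a - p) = 0" and gb_b: "gb (b - p) = 0"
    using a(4) b(4) by (auto simp: ga_def gb_def)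
  have ga_scale: "ga (c *\<^sub>R y) = c * ga y" for c y
    by (simp add: ga_def algebra_simps)
  have "(a - p) \<times> (b - p) \<noteq> 0"
  proof
    assume "(a - p) \<times> (b - p) = 0"
    then obtain c where "b - p = c *\<^sub>R (a - p)"
      using a(3) b(3) by (auto simp: cross_eq_0 collinear_lemma)
    then show False
      using ga_b ga_a ga_scale by simp
  qed
  moreover have "\<exists>\<alpha>\<ge>0. \<exists>\<beta>\<ge>0. x - p = \<alpha> *\<^sub>R (a - p) + \<beta> *\<^sub>R (b - p)" if "x \<in> F" for x
  proof -
    define \<alpha> \<beta> where "\<alpha> = gb (x - p) / gb (a - p)" and "\<beta> = ga (x - p) / ga (b - p)"
    have "0 \<le> gb (x - p)" "0 \<le> ga (x - p)"
      using a(5)[OF that] b(5)[OF that] by (auto simp: ga_def gb_def)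
    then have nonneg: "0 \<le> \<alpha>" "0 \<le> \<beta>"
      using ga_b gb_a by (auto simp: \<alpha>_def \<beta>_def)
    define y where "y = x - p - (\<alpha> *\<^sub>R (a - p) + \<beta> *\<^sub>R (b - p))"
    have "ga y = ga (x - p) - (\<alpha> * ga (a - p) + \<beta> * ga (b - p))"
      unfolding y_def ga_def inner_diff_right[of _ "x - p"] inner_add_right inner_scaleR_right
      by (simp add: algebra_simps)
    then have "ga y = 0"
      using ga_a ga_b by (simp add: \<beta>_def)
    have "gb y = gb (x - p) - (\<alpha> * gb (a - p) + \<beta> * gb (b - p))"
      unfolding y_def gb_def inner_diff_right[of _ "x - p"] inner_add_right inner_scaleR_right
      by (simp add: algebra_simps)
    then have "gb y = 0"
      using gb_b gb_a by (simp add: \<alpha>_def)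
    have "(s + t) * (l \<bullet> y) = 0"
      using \<open>ga y = 0\<close> \<open>gb y = 0\<close> by (simp add: ga_def gb_def algebra_simps)
    then have "l \<bullet> y = 0"
      using \<open>s + t < 0\<close> by simp
    moreover have "w \<bullet> y = 0"
      using \<open>ga y = 0\<close> \<open>l \<bullet> y = 0\<close> by (simp add: ga_def)
    moreover have "n \<bullet> y = 0"
      unfolding y_def inner_diff_right[of _ "x - p"] inner_add_right inner_scaleR_right
      using plane that a(2) b(2) by simp
    ultimately have "y = 0"
      by (intro zero)
    then show ?thesis
      using nonneg by (auto simp: y_def)
  qed
  moreover have "a \<noteq> b"
    using calculation(1) by auto
  ultimately show ?thesis
    using that[OF a(1) b(1) _ a(2) b(2)] by blast
qed

section \<open>Angles of regular polygons\<close>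

text \<open>
  Two directions inside an acute sector form an acute angle.  Contrapositively, a non-acute angle
  between points of a polygon as seen from a vertex forces the interior angle there to be non-acute.
\<close>

lemma acute_sector:
  fixes a b :: "'a::real_inner"
  assumes "0 < a \<bullet> b" "0 \<le> s" "0 \<le> t" "0 \<le> s'" "0 \<le> t'"
    and "s *\<^sub>R a + t *\<^sub>R b \<noteq> 0" "s' *\<^sub>R a + t' *\<^sub>R b \<noteq> 0"
  shows "0 < (s *\<^sub>R a + t *\<^sub>R b) \<bullet> (s' *\<^sub>R a + t' *\<^sub>R b)"
proof -
  have "0 < a \<bullet> a" "0 < b \<bullet> b"
    using assms(1) by auto
  have st: "0 < s \<or> 0 < t" "0 < s' \<or> 0 < t'"
    using assms by (auto simp: less_le)
  have "(s *\<^sub>R a + t *\<^sub>R b) \<bullet> (s' *\<^sub>R a + t' *\<^sub>R b)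
      = (s * s') * (a \<bullet> a) + (s * t' + t * s') * (a \<bullet> b) + (t * t') * (b \<bullet> b)"
    by (simp add: inner_commute algebra_simps)
  also have "\<dots> > 0"
  proof -
    have nn: "0 \<le> (s * s') * (a \<bullet> a)" "0 \<le> (s * t' + t * s') * (a \<bullet> b)" "0 \<le> (t * t') * (b \<bullet> b)"
      using assms(1-5) by auto
    consider "0 < s * s'" | "0 < s * t' + t * s'" | "0 < t * t'"
      using st assms(2-5) by (metis add_nonneg_pos add_pos_nonneg mult_nonneg_nonneg mult_pos_pos)
    then show ?thesis
      using nn \<open>0 < a \<bullet> a\<close> \<open>0 < b \<bullet> b\<close> assms(1)
      by cases (smt (verit) mult_pos_pos)+
  qed
  finally show ?thesis .
qed

lemma angle_at_eq_imp_nonacute: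
  fixes v a b p a' b' :: "'a::euclidean_space"
  assumes "angle_at v a b = angle_at p a' b'" "(a' - p) \<bullet> (b' - p) \<le> 0" "a \<noteq> v" "b \<noteq> v"
  shows "(a - v) \<bullet> (b - v) \<le> 0"
proof -
  have bound: "\<bar>x \<bullet> y / (norm x * norm y)\<bar> \<le> 1" for x y :: 'a
    using Cauchy_Schwarz_ineq2[of x y]
    by (auto simp: abs_mult divide_le_eq_1 le_less)
  have cos_angle: "cos (angle_at u x y) = (x - u) \<bullet> (y - u) / (norm (x - u) * norm (y - u))" for u x y :: 'a
    unfolding angle_at_def by (rule cos_arccos_abs[OF bound])
  have "(a - v) \<bullet> (b - v) / (norm (a - v) * norm (b - v)) = cos (angle_at p a' b')"
    using cos_angle[of v a b] assms(1) by simp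
  also have "\<dots> \<le> 0"
    unfolding cos_angle using assms(2) by (intro divide_nonpos_nonneg) auto
  finally show ?thesis
    using assms(3,4) by (simp add: divide_le_0_iff mult_le_0_iff)
qed

text \<open>
  The four-point argument produces a non-acute angle at some vertex \<open>p\<close>, over which there is no
  control; equiangularity transports it to the given vertex \<open>v\<close>.
\<close>

lemma nontriangular_regular_polygon_nonacute:
  fixes F :: "(real^3) set"
  assumes "regular_polygon F" "\<not> 2 simplex F" "v extreme_point_of F"
  obtains a b where "a \<in> F" "b \<in> F" "(a - v) \<times> (b - v) \<noteq> 0" "(a - v) \<bullet> (b - v) \<le> 0"
proof -
  have F: "polytope F" "aff_dim F = 2" "equiangular F"
    using assms(1) by (auto simp: regular_polygon_def)
  obtain E where E: "card E = 4" "\<forall>x\<in>E. x extreme_point_of F"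
    by (rule four_extreme_points_if_not_triangle[OF F(1,2) assms(2)])
  obtain p q r where pqr: "p \<in> E" "q \<in> E" "r \<in> E" "q \<noteq> p" "r \<noteq> p" "(q - p) \<bullet> (r - p) \<le> 0"
    by (rule nonacute_angle_among_four_extreme_points[OF polytope_imp_convex[OF F(1)] F(2) E(1) E(2)[rule_format]])
  obtain a' b' where p: "closed_segment p a' edge_of F" "closed_segment p b' edge_of F" "a' \<noteq> b'"
    and cone: "\<And>x. x \<in> F \<Longrightarrow> \<exists>s\<ge>0. \<exists>t\<ge>0. x - p = s *\<^sub>R (a' - p) + t *\<^sub>R (b' - p)"
    using polygon_vertex_edges[OF F(1,2) E(2)[rule_format, OF pqr(1)]] by metis
  have "q \<in> F" "r \<in> F"
    using E(2) pqr by (auto simp: extreme_point_of_def)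
  then obtain s t s' t' where st: "0 \<le> s" "0 \<le> t" "0 \<le> s'" "0 \<le> t'"
      "q - p = s *\<^sub>R (a' - p) + t *\<^sub>R (b' - p)" "r - p = s' *\<^sub>R (a' - p) + t' *\<^sub>R (b' - p)"
    using cone by metis
  have nonacute: "(a' - p) \<bullet> (b' - p) \<le> 0"
    using acute_sector[of "a' - p" "b' - p" s t s' t'] st pqr(4-6)
    by (metis eq_iff_diff_eq_0 not_le)
  obtain a b where v: "closed_segment v a edge_of F" "closed_segment v b edge_of F" "a \<noteq> b"
    "a \<in> F" "b \<in> F" "(a - v) \<times> (b - v) \<noteq> 0"
    using polygon_vertex_edges[OF F(1,2) assms(3)] by metis
  have "angle_at v a b = angle_at p a' b'"
    using F(3) v(1-3) p unfolding equiangular_def by blast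
  moreover have "a \<noteq> v" "b \<noteq> v"
    using v(6) by auto
  ultimately have "(a - v) \<bullet> (b - v) \<le> 0"
    using nonacute angle_at_eq_imp_nonacute by blast
  then show ?thesis
    using that v by blast
qed

section \<open>Facets of a polyhedron at a vertex\<close>

lemma facet_normal:
  fixes P :: "'a::euclidean_space set"
  assumes "polyhedron P" "F facet_of P" "v \<in> F"
  obtains n where "\<And>x. x \<in> P \<Longrightarrow> n \<bullet> (x - v) \<le> 0" "\<And>x. x \<in> F \<longleftrightarrow> x \<in> P \<and> n \<bullet> (x - v) = 0"
proof -
  have "F exposed_face_of P"
    using assms by (simp add: exposed_face_of_polyhedron facet_of_def)
  then obtain n d where n: "P \<subseteq> {x. n \<bullet> x \<le> d}" "F = P \<inter> {x. n \<bullet> x = d}"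
    by (auto simp: exposed_face_of_def)
  moreover have "n \<bullet> v = d"
    using n(2) assms(3) by auto
  ultimately show ?thesis
    by (intro that[of n]) (auto simp: inner_diff_right)
qed

text \<open>
  A relative interior point will do: a face that contains it contains the whole facet, and faces of
  equal dimension cannot be nested properly.
\<close>

lemma facet_point_off_other_facets:
  fixes P :: "'a::euclidean_space set"
  assumes "convex P" "F facet_of P"
  obtains x where "x \<in> F" "\<And>G. G facet_of P \<Longrightarrow> x \<in> G \<Longrightarrow> G = F"
proof -
  have F: "F face_of P" "convex F" "F \<noteq> {}"
    using assms by (auto simp: facet_of_def face_of_imp_convex)
  then obtain x where x: "x \<in> rel_interior F"
    using rel_interior_eq_empty by blast
  show ?thesis
  proof
    show "x \<in> F"
      using x rel_interior_subset by blast
    fix G assume G: "G facet_of P" "x \<in> G"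
    then have GP: "G face_of P" "aff_dim G = aff_dim F"
      using assms(2) by (auto simp: facet_of_def)
    then have "F \<subseteq> G"
      using subset_of_face_of[of G P F] F(1) x G(2) face_of_imp_subset by blast
    then have "F face_of G"
      using GP(1) F(1) face_of_face by blast
    then show "G = F"
      using face_of_aff_dim_lt[of G F] GP face_of_imp_convex by fastforce
  qed
qed

theorem theorem1p3:
  fixes P :: "(real^3) set"
  assumes "convex_polyhedron P"
    and "\<And>F. F facet_of P \<Longrightarrow> regular_polygon F"
  shows "\<forall>v. v extreme_point_of P \<longrightarrow> rigid_vertex P v"
proof (intro allI impI)
  fix v assume v: "v extreme_point_of P"
  have P: "polytope P"
    using assms(1) by (simp add: convex_polyhedron_def)
  show "rigid_vertex P v"
  proof (rule ccontr)
    assume "\<not> rigid_vertex P v"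
    then have "4 \<le> card {F. F facet_of P \<and> v \<in> F \<and> \<not> 2 simplex F}"
      using v unfolding rigid_vertex_def non_triangular_degree_def by linarith
    then obtain \<F> where \<F>: "\<F> \<subseteq> {F. F facet_of P \<and> v \<in> F \<and> \<not> 2 simplex F}" "card \<F> = 4"
      by (rule obtain_subset_with_card_n)
    have facet: "F facet_of P" "v \<in> F" "\<not> 2 simplex F" if "F \<in> \<F>" for F
      using that \<F>(1) by auto
    have "\<forall>F\<in>\<F>. \<exists>n. (\<forall>x\<in>P. n \<bullet> (x - v) \<le> 0) \<and> (\<forall>x. x \<in> F \<longleftrightarrow> x \<in> P \<and> n \<bullet> (x - v) = 0)"
    proof
      fix F assume "F \<in> \<F>"
      show "\<exists>n. (\<forall>x\<in>P. n \<bullet> (x - v) \<le> 0) \<and> (\<forall>x. x \<in> F \<longleftrightarrow> x \<in> P \<and> n \<bullet> (x - v) = 0)"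
        by (rule facet_normal[OF polytope_imp_polyhedron[OF P] facet(1,2)[OF \<open>F \<in> \<F>\<close>]]) blast
    qed
    then obtain n where n: "\<And>F x. F \<in> \<F> \<Longrightarrow> x \<in> P \<Longrightarrow> n F \<bullet> (x - v) \<le> 0"
        "\<And>F x. F \<in> \<F> \<Longrightarrow> x \<in> F \<longleftrightarrow> x \<in> P \<and> n F \<bullet> (x - v) = 0"
      by metis
    have "\<forall>F\<in>\<F>. \<exists>x\<in>F. \<forall>G. G facet_of P \<longrightarrow> x \<in> G \<longrightarrow> G = F"
    proof
      fix F assume "F \<in> \<F>"
      show "\<exists>x\<in>F. \<forall>G. G facet_of P \<longrightarrow> x \<in> G \<longrightarrow> G = F"
        by (rule facet_point_off_other_facets[OF polytope_imp_convex[OF P] facet(1)[OF \<open>F \<in> \<F>\<close>]]) blast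
    qed
    then obtain y where y: "\<And>F. F \<in> \<F> \<Longrightarrow> y F \<in> F"
        "\<And>F G. F \<in> \<F> \<Longrightarrow> G facet_of P \<Longrightarrow> y F \<in> G \<Longrightarrow> G = F"
      by metis
    have inj: "inj_on n \<F>"
    proof (rule inj_onI)
      fix F G assume "F \<in> \<F>" "G \<in> \<F>" "n F = n G"
      then show "F = G"
        by (intro set_eqI) (simp add: n(2))
    qed
    \<comment> \<open>The linear-algebra lemma is indexed by normals, so points chosen per facet are looked up by
      inverting \<open>n\<close>.\<close>
    define g where "g = the_inv_into \<F> n"
    have g: "g (n F) = F" if "F \<in> \<F>" for F
      using inj that by (simp add: g_def the_inv_into_f_f)
    have yP: "y F \<in> P" if "F \<in> \<F>" for F
      using y(1)[OF that] n(2)[OF that] by blast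
    show False
    proof (rule no_four_nonacute_facets[of "n ` \<F>" "\<lambda>m. y (g m) - v"])
      show "card (n ` \<F>) = 4"
        using inj \<F>(2) by (simp add: card_image)
      show "m \<bullet> (y (g m) - v) = 0" if "m \<in> n ` \<F>" for m
        using that y(1) n(2) g by force
      show "m' \<bullet> (y (g m) - v) < 0" if m: "m \<in> n ` \<F>" "m' \<in> n ` \<F>" "m' \<noteq> m" for m m'
      proof -
        obtain F F' where FF: "F \<in> \<F>" "m = n F" "F' \<in> \<F>" "m' = n F'"
          using m by auto
        then have "F' \<noteq> F"
          using m(3) by auto
        then have "y F \<notin> F'"
          using y(2)[of F F'] FF \<F>(1) by blast
        then have "n F' \<bullet> (y F - v) \<noteq> 0"
          using n(2)[OF FF(3)] yP[OF FF(1)] by blast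
        then show ?thesis
          using n(1)[OF FF(3) yP[OF FF(1)]] FF g by simp
      qed
      show "\<exists>a b. a \<bullet> b \<le> 0 \<and> a \<times> b \<noteq> 0 \<and> m \<bullet> a = 0 \<and> m \<bullet> b = 0
          \<and> (\<forall>k\<in>n ` \<F>. k \<bullet> a \<le> 0 \<and> k \<bullet> b \<le> 0)" if m: "m \<in> n ` \<F>" for m
      proof -
        obtain F where F: "F \<in> \<F>" "m = n F"
          using m by auto
        have "F face_of P"
          using facet(1)[OF F(1)] by (simp add: facet_of_def)
        then have "v extreme_point_of F"
          using v facet(2)[OF F(1)] by (simp add: extreme_point_of_face)
        then obtain a b where ab: "a \<in> F" "b \<in> F" "(a - v) \<times> (b - v) \<noteq> 0" "(a - v) \<bullet> (b - v) \<le> 0"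
          using nontriangular_regular_polygon_nonacute[OF assms(2)] facet[OF F(1)] by metis
        then have "a \<in> P" "b \<in> P" "n F \<bullet> (a - v) = 0" "n F \<bullet> (b - v) = 0"
          using n(2)[OF F(1)] by auto
        then show ?thesis
          using ab n(1) F by (intro exI[of _ "a - v"] exI[of _ "b - v"]) auto
      qed
    qed
  qed
qed

end
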